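(* Let $a,b,n\ge1$ be integers. Then the Horadam cube $\Pi^{a,b}_n$ contains a Hamiltonian path.
   Context: For integers $a,b\ge1$ and $n\ge 0$, $\mathcal S^{a,b}_n$ is the set of all strings of length $n$ over the alphabet $\{0,1,\dots,a+b-1\}$ in which every letter from $\{a,\dots,a+b-1\}$ appears only immediately after a letter $0$. The Horadam cube $\Pi^{a,b}_n$ is the simple graph with vertex set $\mathcal S^{a,b}_n$ in which $x_1\cdots x_n$ and $y_1\cdots y_n$ are adjacent if and only if $\sum_{i=1}^n|x_i-y_i|=1$. A Hamiltonian path is a path visiting each vertex exactly once. *)

theory Defs
  imports "Graph_Theory.Graph_Theory"
begin

(* The conjunct "0 < i" excludes an initial letter from {a, ..., a + b - 1}: it is not
   immediately preceded by a 0. *)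
definition horadam_strings :: "nat \<Rightarrow> nat \<Rightarrow> nat \<Rightarrow> nat list set" where
  "horadam_strings a b n =
    {x. length x = n \<and> set x \<subseteq> {..<a + b} \<and>
        (\<forall>i<n. x ! i \<in> {a..<a + b} \<longrightarrow> 0 < i \<and> x ! (i - 1) = 0)}"

(* A simple graph is a symmetric loop-free digraph, as in Graph_Theory: an edge is a pair
   of opposite arcs. *)
definition horadam_cube :: "nat \<Rightarrow> nat \<Rightarrow> nat \<Rightarrow> nat list pair_pre_digraph" where
  "horadam_cube a b n =
    \<lparr> pverts = horadam_strings a b n,
      parcs = {(x, y). x \<in> horadam_strings a b n \<and> y \<in> horadam_strings a b n \<and>
                       (\<Sum>i<n. \<bar>int (x ! i) - int (y ! i)\<bar>) = 1} \<rparr>"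

lemma finite_horadam_strings: "finite (horadam_strings a b n)"
  by (rule finite_subset[OF _ finite_lists_length_eq[of "{..<a + b}" n]])
     (auto simp: horadam_strings_def)

lemma pair_graph_horadam_cube: "pair_graph (horadam_cube a b n)"
proof
  show "finite (parcs (horadam_cube a b n))"
    by (rule finite_subset[of _ "horadam_strings a b n \<times> horadam_strings a b n"])
       (auto simp: horadam_cube_def finite_horadam_strings)
qed (auto simp: horadam_cube_def finite_horadam_strings symmetric_def abs_minus_commute
          intro!: symI)

definition hamiltonian_path :: "('a, 'b) pre_digraph \<Rightarrow> 'a list \<Rightarrow> bool" where
  "hamiltonian_path G p \<longleftrightarrow> vpath p G \<and> set p = verts G"

end

(* Write S for the strings of length m in the cube and T \<supseteq> S for those in which the first
   letter may be any of the a + b letters (what may follow a 0). Both are split by the first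
   letter: layer 0 is a copy of T in length m - 1, every other layer is a copy of S in length
   m - 1. If S and T have Hamiltonian paths in length m - 1 with the same first vertex, then
   traversing layer 0 against the direction of the path of T, layer 1 along the path of S,
   layer 2 against it, and so on, gives Hamiltonian paths of S and T in length m, and again
   they have the same first vertex, as both begin with layer 0. *)

theory Submission
  imports Defs
begin

text \<open>Reading the length off the lists lets adjacency pass through \<open>(#)\<close>.\<close>

definition unit_step :: "nat list \<Rightarrow> nat list \<Rightarrow> bool" where
  "unit_step x y \<longleftrightarrow>
    length x = length y \<and> (\<Sum>i<length x. \<bar>int (x ! i) - int (y ! i)\<bar>) = 1"

lemma unit_step_sym: "unit_step x y \<longleftrightarrow> unit_step y x"
  by (auto simp: unit_step_def abs_minus_commute)

lemma unit_step_Cons_same [simp]: "unit_step (j # x) (j # y) \<longleftrightarrow> unit_step x y"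
  by (auto simp: unit_step_def sum.lessThan_Suc_shift simp del: sum.lessThan_Suc)

lemma unit_step_Cons_Suc [simp]: "unit_step (j # x) (Suc j # x)"
  by (auto simp: unit_step_def sum.lessThan_Suc_shift simp del: sum.lessThan_Suc)

text \<open>\<open>q\<close> serves for layer 0 and \<open>p\<close> for every other layer; with the
  number \<open>c\<close> of layers as a parameter, one function covers both S and T.\<close>

primrec snake :: "nat list list \<Rightarrow> nat list list \<Rightarrow> nat \<Rightarrow> nat list list" where
  "snake q p 0 = []"
| "snake q p (Suc j) = snake q p j @
     map ((#) j) (if j = 0 then rev q else if odd j then p else rev p)"

lemma snake_eq_Nil_iff [simp]: "q \<noteq> [] \<Longrightarrow> snake q p c = [] \<longleftrightarrow> c = 0"
  by (induction c) auto

lemma hd_snake: "q \<noteq> [] \<Longrightarrow> c > 0 \<Longrightarrow> hd (snake q p c) = 0 # last q"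
  by (induction c) (auto simp: hd_append hd_map hd_rev)

text \<open>Layer 0 fits the even case because \<open>rev q\<close> ends in \<open>hd q\<close>,
  which is \<open>hd p\<close>.\<close>

lemma last_snake_Suc:
  assumes "q \<noteq> []" "p \<noteq> []" "hd p = hd q"
  shows "last (snake q p (Suc j)) = j # (if odd j then last p else hd p)"
  using assms by (auto simp: last_map last_rev)

lemma set_snake:
  "set (snake q p c) = {j # x |j x. j < c \<and> x \<in> (if j = 0 then set q else set p)}"
  by (induction c) (auto simp: less_Suc_eq split: if_splits)

lemma distinct_snake: "distinct q \<Longrightarrow> distinct p \<Longrightarrow> distinct (snake q p c)"
  by (induction c) (auto simp: set_snake distinct_map split: if_splits)

text \<open>Neighbouring layers run in opposite directions, so each begins at the string where the
  previous one ends; the crossing only raises the first letter by one.\<close>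

lemma successively_snake:
  assumes "q \<noteq> []" "p \<noteq> []" "hd p = hd q"
    and "successively unit_step q" "successively unit_step p"
  shows "successively unit_step (snake q p c)"
proof (induction c)
  case (Suc c)
  have rev: "successively unit_step (rev q)" "successively unit_step (rev p)"
    using assms(4,5) by (simp_all add: unit_step_sym)
  have "unit_step (last (snake q p c))
      (hd (map ((#) c) (if c = 0 then rev q else if odd c then p else rev p)))" if "c > 0"
  proof -
    from that obtain j where c: "c = Suc j" by (auto simp: gr0_conv_Suc)
    show ?thesis
      unfolding c last_snake_Suc[OF assms(1-3)] using assms(2) by (auto simp: hd_map hd_rev)
  qed
  with Suc.IH rev assms(1,5) show ?case
    by (auto simp: successively_append_iff successively_map)
qed simp

text \<open>\<open>c\<close> bounds the first letter: \<open>c = a\<close> gives the path of S,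
  \<open>c = a + b\<close> that of T.\<close>

primrec cube_path :: "nat \<Rightarrow> nat \<Rightarrow> nat \<Rightarrow> nat \<Rightarrow> nat list list" where
  "cube_path a b 0 c = [[]]"
| "cube_path a b (Suc m) c = snake (cube_path a b m (a + b)) (cube_path a b m a) c"

lemma cube_path_nonempty: "a > 0 \<Longrightarrow> c > 0 \<Longrightarrow> cube_path a b m c \<noteq> []"
  by (induction m arbitrary: c) auto

text \<open>Layer 0 comes first for every positive bound, and its path does not depend on the
  bound.\<close>

lemma hd_cube_path: "a > 0 \<Longrightarrow> c > 0 \<Longrightarrow> d > 0 \<Longrightarrow> hd (cube_path a b m c) = hd (cube_path a b m d)"
  by (cases m) (auto simp: hd_snake cube_path_nonempty)

lemma distinct_cube_path: "distinct (cube_path a b m c)"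
  by (induction m arbitrary: c) (auto simp: distinct_snake)

lemma successively_cube_path:
  "a > 0 \<Longrightarrow> successively unit_step (cube_path a b m c)"
  by (induction m arbitrary: c)
    (auto intro!: successively_snake simp: cube_path_nonempty intro: hd_cube_path)

text \<open>A left-to-right form of the string condition whose recursion mirrors that of
  \<open>cube_path\<close>.\<close>

primrec admissible :: "nat \<Rightarrow> nat \<Rightarrow> nat \<Rightarrow> nat list \<Rightarrow> bool" where
  "admissible a b c [] \<longleftrightarrow> True"
| "admissible a b c (j # x) \<longleftrightarrow> j < c \<and> admissible a b (if j = 0 then a + b else a) x"

lemma set_cube_path: "set (cube_path a b m c) = {x. length x = m \<and> admissible a b c x}"
  by (induction m arbitrary: c) (auto simp: set_snake length_Suc_conv split: if_splits)

text \<open>The bound stays general for the induction: the tail gets \<open>a + b\<close> after a 0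
  and \<open>a\<close> otherwise.\<close>

lemma admissible_iff:
  assumes "a > 0" "c \<le> a + b" "a \<le> c"
  shows "admissible a b c x \<longleftrightarrow> set x \<subseteq> {..<a + b} \<and>
    (\<forall>i<length x. a \<le> x ! i \<longrightarrow> (if i = 0 then x ! i < c else x ! (i - 1) = 0))"
  using assms(2,3)
proof (induction x arbitrary: c)
  case (Cons j x)
  \<comment> \<open>Index 0 yields \<open>j < c\<close>, since letters below \<open>a\<close> are
    below \<open>c\<close> anyway; index 1 becomes index 0 of \<open>x\<close>, with predecessor
    \<open>j\<close>.\<close>
  have "(\<forall>i<length (j # x). a \<le> (j # x) ! i \<longrightarrow>
          (if i = 0 then (j # x) ! i < c else (j # x) ! (i - 1) = 0)) \<longleftrightarrow>
      j < c \<and> (\<forall>i<length x. a \<le> x ! i \<longrightarrow> (if i = 0 then j = 0 else x ! (i - 1) = 0))"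
    using Cons.prems by (auto simp: All_less_Suc2 nth_Cons')
  \<comment> \<open>For \<open>j = 0\<close> the bound on the head of the tail already follows from
    the alphabet.\<close>
  moreover have "x ! 0 < a + b" if "set x \<subseteq> {..<a + b}" "0 < length x"
    using that by (auto simp: subset_iff)
  ultimately show ?case
    using Cons.prems by (cases "j = 0") (auto simp: Cons.IH)
qed simp

lemma horadam_strings_eq:
  assumes "a > 0"
  shows "horadam_strings a b n = set (cube_path a b n a)"
proof -
  \<comment> \<open>The two forms differ only at \<open>i = 0\<close>, where both amount to
    \<open>x ! 0 < a\<close>.\<close>
  have "(\<forall>i<n. x ! i \<in> {a..<a + b} \<longrightarrow> 0 < i \<and> x ! (i - 1) = 0) \<longleftrightarrow>
      (\<forall>i<n. a \<le> x ! i \<longrightarrow> (if i = 0 then x ! i < a else x ! (i - 1) = 0))"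
    if "length x = n" "set x \<subseteq> {..<a + b}" for x
  proof -
    have "x ! i < a + b" if "i < n" for i
      using that \<open>length x = n\<close> \<open>set x \<subseteq> _\<close> by (auto simp: subset_iff)
    then show ?thesis by (auto simp: not_less intro: gr0I)
  qed
  then show ?thesis
    unfolding horadam_strings_def set_cube_path admissible_iff[OF assms le_add1 order_refl]
    by (intro Collect_cong conj_cong refl) (simp only:)
qed

lemma set_vwalk_arcs_if_successively:
  "successively P p \<Longrightarrow> set (vwalk_arcs p) \<subseteq> {(x, y). x \<in> set p \<and> y \<in> set p \<and> P x y}"
  by (induction p rule: vwalk_arcs.induct) auto

theorem theorem14:
  fixes a b n :: nat
  assumes "a \<ge> 1" and "b \<ge> 1" and "n \<ge> 1"
  shows "\<exists>p. hamiltonian_path (with_proj (horadam_cube a b n)) p"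
proof
  let ?p = "cube_path a b n a"
  from assms(1) have a: "a > 0" by simp
  have "set (vwalk_arcs ?p) \<subseteq> parcs (horadam_cube a b n)"
  proof
    fix e assume "e \<in> set (vwalk_arcs ?p)"
    then obtain x y where "e = (x, y)" "x \<in> set ?p" "y \<in> set ?p" "unit_step x y"
      using set_vwalk_arcs_if_successively[OF successively_cube_path[OF a]] by blast
    then show "e \<in> parcs (horadam_cube a b n)"
      by (auto simp: horadam_cube_def horadam_strings_eq[OF a] unit_step_def set_cube_path)
  qed
  then have "vwalk ?p (with_proj (horadam_cube a b n))"
    using cube_path_nonempty[OF a a]
    by (auto simp: vwalk_def arcs_ends_def arc_to_ends_def horadam_cube_def horadam_strings_eq[OF a])
  then show "hamiltonian_path (with_proj (horadam_cube a b n)) ?p"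
    by (simp add: hamiltonian_path_def vpath_def distinct_cube_path horadam_cube_def
        horadam_strings_eq[OF a])
qed

end
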